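(* Let $p>1$ and let $u_0$ be any function in $L^\infty(\mathbb{R}^n,\mathbb{C})$ such that $\mathrm{Re}(u_0(x))\ge\lambda$ for all $x\in\mathbb{R}^n$, for some constant $\lambda>0$. Then there exists $T_1>0$ such that the equation $\partial_t u=\Delta u+u^p$ with initial data $u_0$ has a unique solution on $(0,T_1]$. Moreover, $u\in C\left((0,T_1],L^\infty(\mathbb{R}^n)\right)$ and $$\mathrm{Re}(u(t,x))\ge\frac\lambda2\quad\text{for all }(t,x)\in[0,T_1]\times\mathbb{R}^n.$$
   Context: Here $u(t):\mathbb{R}^n\to\mathbb{C}$. For $u=u_1+iu_2\in\mathbb{C}$ with $u_1>0$, $u^p=|u|^p\left(\cos[p\,\mathrm{Arg}(u_1,u_2)]+i\sin[p\,\mathrm{Arg}(u_1,u_2)]\right)$ with $\mathrm{Arg}(u_1,u_2)=\arcsin\left[\frac{u_2}{\sqrt{u_1^2+u_2^2}}\right]$. A solution with initial data $u_0$ is understood in the Duhamel (mild) sense: it takes values in the half-plane of positive real part, where $u^p$ is defined, and $u(t)=e^{t\Delta}u_0+\int_0^te^{(t-s)\Delta}(u^p(s))\,ds$, where $e^{t\Delta}$ is the heat semigroup on $\mathbb{R}^n$. *)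

theory Defs
  imports "HOL-Analysis.Analysis" "HOL-Probability.Essential_Supremum"
begin

definition arg_half :: "real \<Rightarrow> real \<Rightarrow> real" where
  "arg_half a b = arcsin (b / sqrt (a\<^sup>2 + b\<^sup>2))"

text \<open>The power \<open>u^p\<close>; only meaningful for \<open>Re u > 0\<close>.\<close>

definition cpow :: "real \<Rightarrow> complex \<Rightarrow> complex" where
  "cpow p u = of_real (norm u powr p) *
     (of_real (cos (p * arg_half (Re u) (Im u))) + \<i> * of_real (sin (p * arg_half (Re u) (Im u))))"

definition Linfty_norm :: "'a measure \<Rightarrow> ('a \<Rightarrow> complex) \<Rightarrow> ereal" where
  "Linfty_norm M f = esssup M (\<lambda>x. ereal (norm (f x)))"

text \<open>Elements of \<open>L\<^sup>\<infinity>\<close> are represented by functions; equality in \<open>L\<^sup>\<infinity>\<close> is equality almost everywhere.\<close>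

definition Linfty :: "'a measure \<Rightarrow> ('a \<Rightarrow> complex) set" where
  "Linfty M = {f \<in> borel_measurable M. Linfty_norm M f < \<infinity>}"

text \<open>Norm continuity on \<open>I\<close> of a map into \<open>L\<^sup>\<infinity>(\<real>\<^sup>n)\<close>.\<close>

definition continuous_on_Linfty :: "real set \<Rightarrow> (real \<Rightarrow> real ^ 'n \<Rightarrow> complex) \<Rightarrow> bool" where
  "continuous_on_Linfty I u \<longleftrightarrow>
     (\<forall>t\<in>I. u t \<in> Linfty lebesgue) \<and>
     (\<forall>t\<in>I. ((\<lambda>s. Linfty_norm lebesgue (\<lambda>x. u s x - u t x)) \<longlongrightarrow> 0) (at t within I))"

definition heat_kernel :: "real \<Rightarrow> real ^ 'n \<Rightarrow> real" where
  "heat_kernel t x = (4 * pi * t) powr (- real CARD('n) / 2) * exp (- (norm x)\<^sup>2 / (4 * t))"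

definition heat_semigroup :: "real \<Rightarrow> (real ^ 'n \<Rightarrow> complex) \<Rightarrow> real ^ 'n \<Rightarrow> complex" where
  "heat_semigroup t f x =
     (if t = 0 then f x else (LINT y|lebesgue. heat_kernel t (x - y) *\<^sub>R f y))"

text \<open>
  Bounded mild solutions on \<open>(0,T]\<close> of \<open>\<partial>\<^sub>t u = \<Delta> u + u^p\<close> with initial data \<open>u\<^sub>0\<close>: elements of
  \<open>L\<^sup>\<infinity>((0,T) \<times> \<real>\<^sup>n)\<close> satisfying the Duhamel formula in \<open>L\<^sup>\<infinity>(\<real>\<^sup>n)\<close> at every time. At \<open>t = 0\<close>
  the formula is the initial condition. No continuity in time is built in. Boundedness up to
  \<open>t = 0\<close> makes all the integrals absolutely convergent.
\<close>

definition mild_solution ::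
  "real \<Rightarrow> (real ^ 'n \<Rightarrow> complex) \<Rightarrow> real \<Rightarrow> (real \<Rightarrow> real ^ 'n \<Rightarrow> complex) \<Rightarrow> bool" where
  "mild_solution p u\<^sub>0 T u \<longleftrightarrow>
     (\<lambda>(t, x). u t x) \<in> Linfty (lebesgue_on ({0<..<T} \<times> UNIV)) \<and>
     (\<forall>t\<in>{0..T}. u t \<in> Linfty lebesgue) \<and>
     (\<forall>t\<in>{0..T}. AE x in lebesgue. Re (u t x) > 0) \<and>
     (\<forall>t\<in>{0..T}. AE x in lebesgue.
        u t x = heat_semigroup t u\<^sub>0 x +
          (LINT s:{0..t}|lebesgue. heat_semigroup (t - s) (\<lambda>y. cpow p (u s y)) x))"

end

theory Submission
  imports Defs "HOL-Probability.Distributions"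
begin

text \<open>
  On bounded subsets of the right half-plane \<open>u\<^sup>p\<close> is Lipschitz, since its derivative
  \<open>p u\<^sup>p\<^sup>-\<^sup>1\<close> is bounded there and these sets are convex. The heat kernel is a probability
  density, so the free evolution preserves both the bound \<open>\<bar>u\<bar> \<le> M\<close> and the bound
  \<open>Re u \<ge> \<lambda>\<close>, while the Duhamel term is of size \<open>O(T)\<close>. For small \<open>T\<close> Picard iteration
  therefore stays in \<open>{Re z \<ge> \<lambda> / 2, \<bar>z\<bar> \<le> M + \<lambda> / 2}\<close> and contracts in the
  supremum norm. To avoid null sets the iteration is run with Borel representatives, for which the
  Duhamel formula holds at every point. Continuity in time follows from
  \<open>\<parallel>G\<^sub>t - G\<^sub>s\<parallel>\<^sub>1 \<le> 2((t/s)\<^sup>n\<^sup>/\<^sup>2 - 1)\<close> for \<open>s \<le> t\<close>.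
\<close>

subsection \<open>The heat semigroup\<close>

lemma heat_kernel_nonneg: "0 \<le> heat_kernel t x"
  by (simp add: heat_kernel_def)

lemma borel_measurable_heat_kernel [measurable (raw)]:
  fixes g :: "'a \<Rightarrow> real ^ 'n"
  assumes [measurable]: "f \<in> borel_measurable M" "g \<in> borel_measurable M"
  shows "(\<lambda>w. heat_kernel (f w) (g w)) \<in> borel_measurable M"
  unfolding heat_kernel_def by measurable

text \<open>The kernel is the joint density of independent centred normal variables of variance
  \<open>2 * t\<close>, one per coordinate. This reduces its total mass to the one-dimensional
  normal density.\<close>

lemma heat_kernel_eq_prod:
  fixes x :: "real ^ 'n"
  assumes "t > 0"
  shows "heat_kernel t x = (\<Prod>b\<in>Basis. normal_density 0 (sqrt (2 * t)) (x \<bullet> b))"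
proof -
  have pos: "4 * pi * t > 0" using assms by simp
  have "(4 * pi * t) powr (- real CARD('n) / 2) = ((4 * pi * t) powr (- 1 / 2)) powr real CARD('n)"
    by (simp add: powr_powr)
  also have "\<dots> = (1 / sqrt (4 * pi * t)) ^ CARD('n)"
    using pos by (simp add: powr_realpow powr_minus_divide powr_half_sqrt)
  finally have 1: "(4 * pi * t) powr (- real CARD('n) / 2) = (1 / sqrt (4 * pi * t)) ^ CARD('n)" .
  have "(norm x)\<^sup>2 = (\<Sum>b\<in>Basis. (x \<bullet> b)\<^sup>2)"
    unfolding power2_norm_eq_inner by (subst euclidean_inner) (simp add: power2_eq_square)
  then have 2: "- (norm x)\<^sup>2 / (4 * t) = (\<Sum>b\<in>Basis. - (x \<bullet> b)\<^sup>2 / (4 * t))"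
    by (simp add: sum_negf sum_divide_distrib)
  show ?thesis
    unfolding heat_kernel_def 1 2 normal_density_def
    using assms by (simp add: prod_dividef exp_sum power_one_over ac_simps)
qed

text \<open>Tonelli over the coordinates gives mass 1 for the kernel centred at the origin; evenness
  and translation invariance of \<open>lborel\<close> move the centre to \<open>x\<close>.\<close>

lemma nn_integral_heat_kernel:
  fixes x :: "real ^ 'n"
  assumes "t > 0"
  shows "(\<integral>\<^sup>+y. heat_kernel t (x - y) \<partial>lborel) = 1"
proof -
  have "(\<integral>\<^sup>+z. normal_density 0 (sqrt (2 * t)) z \<partial>lborel) = 1"
    using assms by (simp add: nn_integral_eq_integral)
  then have 1: "(\<integral>\<^sup>+y. heat_kernel t y \<partial>(lborel :: (real ^ 'n) measure)) = 1"
    using nn_integral_lborel_prod[where 'a = "real ^ 'n"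
        and f = "\<lambda>_ z. ennreal (normal_density 0 (sqrt (2 * t)) z)"] assms
    by (simp add: heat_kernel_eq_prod prod_ennreal)
  have "(\<integral>\<^sup>+y. heat_kernel t (x - y) \<partial>lborel) = (\<integral>\<^sup>+y. heat_kernel t (- x + y) \<partial>lborel)"
    by (simp add: heat_kernel_def norm_minus_commute)
  also have "\<dots> = (\<integral>\<^sup>+y. heat_kernel t y \<partial>distr lborel borel ((+) (- x)))"
    by (subst nn_integral_distr) simp_all
  finally show ?thesis by (simp add: lborel_distr_plus 1)
qed

lemma
  fixes x :: "real ^ 'n"
  assumes "t > 0"
  shows integrable_heat_kernel: "integrable lborel (\<lambda>y. heat_kernel t (x - y))"
    and integral_heat_kernel: "(LINT y|lborel. heat_kernel t (x - y)) = 1"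
proof -
  have "has_bochner_integral lborel (\<lambda>y. heat_kernel t (x - y)) 1"
    by (rule has_bochner_integral_nn_integral)
       (simp_all add: heat_kernel_nonneg nn_integral_heat_kernel[OF assms])
  then show "integrable lborel (\<lambda>y. heat_kernel t (x - y))" "(LINT y|lborel. heat_kernel t (x - y)) = 1"
    by (simp_all add: has_bochner_integral_iff)
qed

text \<open>The Gaussian exponential grows with time, so only the normalising factors have to be
  compared, and their quotient is the stated power.\<close>

lemma heat_kernel_le:
  fixes x :: "real ^ 'n"
  assumes "0 < s" "s \<le> t"
  shows "heat_kernel s x \<le> (t / s) powr (real CARD('n) / 2) * heat_kernel t x"
proof -
  have "(t / s) powr (real CARD('n) / 2) * (4 * pi * t) powr (- real CARD('n) / 2)
      = (4 * pi * s) powr (- real CARD('n) / 2)"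
    using assms by (simp add: powr_divide powr_mult powr_minus_divide)
  moreover have "- (norm x)\<^sup>2 / (4 * s) \<le> - (norm x)\<^sup>2 / (4 * t)"
    using assms by (simp add: frac_le)
  ultimately show ?thesis
    unfolding heat_kernel_def by (simp add: mult.assoc[symmetric] mult_left_mono)
qed

section \<open>Passing from Lebesgue to Borel integrands\<close>

lemma (in complete_measure) borel_measurable_AE_cong:
  fixes f g :: "'a \<Rightarrow> 'b :: topological_space"
  assumes f: "f \<in> borel_measurable M" and eq: "AE x in M. g x = f x"
  shows "g \<in> borel_measurable M"
proof (rule measurableI)
  fix A :: "'b set"
  assume "A \<in> sets borel"
  then have A: "f -` A \<inter> space M \<in> sets M" by (rule measurable_sets[OF f])
  have "AE x in M. x \<in> f -` A \<inter> space M \<longleftrightarrow> x \<in> g -` A \<inter> space M"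
    using eq by eventually_elim auto
  then show "g -` A \<inter> space M \<in> sets M" using A by (rule in_sets_AE) auto
qed simp

text \<open>The definitions integrate against \<open>lebesgue\<close>, the completion of
  \<open>lborel\<close>, whereas product measurability and Fubini arguments are carried out for
  Borel functions. This is the bridge: \<open>g\<close> need only agree almost everywhere with an
  \<open>M\<close>-measurable \<open>f\<close>.\<close>

lemma integral_completion_cong_AE:
  fixes f g :: "'a \<Rightarrow> 'b :: {banach, second_countable_topology}"
  assumes f: "f \<in> borel_measurable M" and eq: "AE x in M. g x = f x"
  shows "integral\<^sup>L (completion M) g = integral\<^sup>L M f"
proof -
  have f': "f \<in> borel_measurable (completion M)" using f by (rule measurable_completion)
  have eq': "AE x in completion M. g x = f x" using eq by (rule AE_completion)
  have "integral\<^sup>L (completion M) g = integral\<^sup>L (completion M) f"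
    using completion.borel_measurable_AE_cong[OF f' eq'] f' eq' by (rule integral_cong_AE)
  also have "\<dots> = integral\<^sup>L M f" using f by (rule integral_completion)
  finally show ?thesis .
qed

text \<open>For \<open>t \<noteq> 0\<close> the semigroup is an integral and ignores null sets. At
  \<open>t = 0\<close> it is evaluation at \<open>x\<close>, which does see them, so that time is
  excluded here.\<close>

lemma heat_semigroup_cong_AE:
  fixes f g :: "real ^ 'n \<Rightarrow> complex"
  assumes "t \<noteq> 0" and [measurable]: "f \<in> borel_measurable borel" and "AE y in lborel. g y = f y"
  shows "heat_semigroup t g x = (LINT y|lborel. heat_kernel t (x - y) *\<^sub>R f y)"
  using assms unfolding heat_semigroup_def
  by (simp, intro integral_completion_cong_AE) auto

lemma heat_semigroup_eq_lborel:
  fixes f :: "real ^ 'n \<Rightarrow> complex"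
  assumes "f \<in> borel_measurable borel"
  shows "heat_semigroup t f x =
    (if t = 0 then f x else LINT y|lborel. heat_kernel t (x - y) *\<^sub>R f y)"
  using heat_semigroup_cong_AE[of t f f x] assms by (simp add: heat_semigroup_def)

text \<open>Agreement at the point \<open>x\<close> itself covers the case
  \<open>t = 0\<close>.\<close>

lemma heat_semigroup_eq_if_AE_eq:
  fixes f g :: "real ^ 'n \<Rightarrow> complex"
  assumes "f \<in> borel_measurable borel" "AE y in lborel. g y = f y" "g x = f x"
  shows "heat_semigroup t g x = heat_semigroup t f x"
proof (cases "t = 0")
  case False
  then show ?thesis using assms by (simp add: heat_semigroup_cong_AE heat_semigroup_eq_lborel)
qed (use assms in \<open>simp add: heat_semigroup_def\<close>)

section \<open>The semigroup on bounded functions\<close>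

lemma integrable_heat:
  fixes f :: "real ^ 'n \<Rightarrow> complex"
  assumes t: "t > 0" and [measurable]: "f \<in> borel_measurable borel"
    and C: "AE y in lborel. norm (f y) \<le> C"
  shows "integrable lborel (\<lambda>y. heat_kernel t (x - y) *\<^sub>R f y)"
proof (rule Bochner_Integration.integrable_bound)
  show "integrable lborel (\<lambda>y. heat_kernel t (x - y) * C)"
    using integrable_heat_kernel[OF t, of x] by simp
  show "AE y in lborel. norm (heat_kernel t (x - y) *\<^sub>R f y) \<le> norm (heat_kernel t (x - y) * C)"
    using C by eventually_elim
      (auto simp: heat_kernel_nonneg abs_mult intro!: mult_left_mono)
qed measurable

lemma norm_heat_semigroup_le_AE:
  fixes f :: "real ^ 'n \<Rightarrow> complex"
  assumes t: "t > 0" and [measurable]: "f \<in> borel_measurable borel"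
    and C: "AE y in lborel. norm (f y) \<le> C"
  shows "norm (heat_semigroup t f x) \<le> C"
proof -
  have "norm (LINT y|lborel. heat_kernel t (x - y) *\<^sub>R f y)
      \<le> (LINT y|lborel. norm (heat_kernel t (x - y) *\<^sub>R f y))"
    by (rule integral_norm_bound)
  also have "\<dots> \<le> (LINT y|lborel. heat_kernel t (x - y) * C)"
  proof (rule integral_mono_AE)
    show "AE y in lborel. norm (heat_kernel t (x - y) *\<^sub>R f y) \<le> heat_kernel t (x - y) * C"
      using C by eventually_elim (auto simp: heat_kernel_nonneg intro!: mult_left_mono)
  qed (use integrable_norm[OF integrable_heat[OF assms, of x]] integrable_heat_kernel[OF t, of x] in simp_all)
  also have "\<dots> = C" using integral_heat_kernel[OF t, of x] by simp
  finally show ?thesis using t by (simp add: heat_semigroup_eq_lborel)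
qed

lemma norm_heat_semigroup_le:
  fixes f :: "real ^ 'n \<Rightarrow> complex"
  assumes "t \<ge> 0" "f \<in> borel_measurable borel" "\<And>y. norm (f y) \<le> C"
  shows "norm (heat_semigroup t f x) \<le> C"
proof (cases "t = 0")
  case False
  then show ?thesis using assms by (intro norm_heat_semigroup_le_AE) auto
qed (use assms in \<open>simp add: heat_semigroup_def\<close>)

lemma heat_semigroup_diff:
  fixes f g :: "real ^ 'n \<Rightarrow> complex"
  assumes t: "t \<ge> 0" and [measurable]: "f \<in> borel_measurable borel" "g \<in> borel_measurable borel"
    and bounded: "\<And>y. norm (f y) \<le> C" "\<And>y. norm (g y) \<le> C"
  shows "heat_semigroup t f x - heat_semigroup t g x = heat_semigroup t (\<lambda>y. f y - g y) x"
proof (cases "t = 0")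
  case False
  then have "integrable lborel (\<lambda>y. heat_kernel t (x - y) *\<^sub>R f y)"
    "integrable lborel (\<lambda>y. heat_kernel t (x - y) *\<^sub>R g y)"
    using t bounded by (intro integrable_heat[where C = C]; simp)+
  then show ?thesis
    using False by (simp add: heat_semigroup_eq_lborel scaleR_diff_right)
qed (simp add: heat_semigroup_def)

lemma Re_heat_semigroup_ge:
  fixes f :: "real ^ 'n \<Rightarrow> complex"
  assumes t: "t \<ge> 0" and [measurable]: "f \<in> borel_measurable borel"
    and bounded: "\<And>y. norm (f y) \<le> C" and lower: "\<And>y. Re (f y) \<ge> l"
  shows "Re (heat_semigroup t f x) \<ge> l"
proof (cases "t = 0")
  case False
  then have t: "t > 0" using t by simp
  have int: "integrable lborel (\<lambda>y. heat_kernel t (x - y) *\<^sub>R f y)"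
    using t bounded by (intro integrable_heat[where C = C]; simp)
  have "l = (LINT y|lborel. heat_kernel t (x - y) * l)"
    using integral_heat_kernel[OF t, of x] by simp
  also have "\<dots> \<le> (LINT y|lborel. Re (heat_kernel t (x - y) *\<^sub>R f y))"
  proof (rule integral_mono)
    show "integrable lborel (\<lambda>y. Re (heat_kernel t (x - y) *\<^sub>R f y))"
      using int by (rule integrable_Re)
  qed (use integrable_heat_kernel[OF t, of x] in \<open>auto simp: heat_kernel_nonneg lower intro!: mult_left_mono\<close>)
  also have "\<dots> = Re (heat_semigroup t f x)"
    using t int by (simp add: heat_semigroup_eq_lborel del: scaleR_complex.sel)
  finally show ?thesis .
qed (use assms in \<open>simp add: heat_semigroup_def\<close>)

text \<open>Since \<open>heat_kernel s \<le> k * heat_kernel t\<close> with \<open>k = (t / s) powr (n / 2) \<ge> 1\<close>, the kernels at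
  times \<open>s\<close> and \<open>t\<close> have \<open>L\<^sup>1\<close> distance at most \<open>2 * (k - 1)\<close>.\<close>

lemma norm_heat_semigroup_time_diff_le:
  fixes f :: "real ^ 'n \<Rightarrow> complex"
  assumes st: "0 < s" "s \<le> t" and [measurable]: "f \<in> borel_measurable borel"
    and bounded: "\<And>y. norm (f y) \<le> C"
  shows "norm (heat_semigroup t f x - heat_semigroup s f x)
    \<le> 2 * C * ((t / s) powr (real CARD('n) / 2) - 1)"
proof -
  define k where "k = (t / s) powr (real CARD('n) / 2)"
  have k: "k \<ge> 1" using st by (simp add: k_def ge_one_powr_ge_zero)
  have t: "t > 0" using st by simp
  have C: "C \<ge> 0" using bounded[of 0] norm_ge_zero[of "f 0"] by linarith
  note kint [simp] = integrable_heat_kernel[OF t, of x] integrable_heat_kernel[OF st(1), of x]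
  \<comment> \<open>Write \<open>a\<close>, \<open>b\<close> for the kernels at times
    \<open>t\<close>, \<open>s\<close>. Both are at most \<open>k * a\<close>, so their distance is
    at most \<open>(k * a - a) + (k * a - b) = (2 * k - 1) * a - b\<close>, which has integral
    \<open>2 * (k - 1)\<close>.\<close>
  let ?D = "\<lambda>y. ((2 * k - 1) * heat_kernel t (x - y) - heat_kernel s (x - y)) * C"
  have int: "integrable lborel (\<lambda>y. heat_kernel t (x - y) *\<^sub>R f y)"
    "integrable lborel (\<lambda>y. heat_kernel s (x - y) *\<^sub>R f y)"
    using st bounded by (intro integrable_heat[where C = C]; simp)+
  have "heat_semigroup t f x - heat_semigroup s f x
      = (LINT y|lborel. heat_kernel t (x - y) *\<^sub>R f y - heat_kernel s (x - y) *\<^sub>R f y)"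
    using st t int by (simp add: heat_semigroup_eq_lborel)
  also have "norm \<dots> \<le> (LINT y|lborel. norm (heat_kernel t (x - y) *\<^sub>R f y - heat_kernel s (x - y) *\<^sub>R f y))"
    by (rule integral_norm_bound)
  also have "\<dots> \<le> (LINT y|lborel. ?D y)"
  proof (rule integral_mono)
    fix y
    have "\<bar>heat_kernel t (x - y) - heat_kernel s (x - y)\<bar>
        \<le> (2 * k - 1) * heat_kernel t (x - y) - heat_kernel s (x - y)"
    proof -
      have "heat_kernel s (x - y) \<le> k * heat_kernel t (x - y)"
        unfolding k_def using st by (rule heat_kernel_le)
      moreover have "heat_kernel t (x - y) \<le> k * heat_kernel t (x - y)"
        using k by (simp add: heat_kernel_nonneg mult_left_le_one_le mult_right_mono[of 1 k, simplified])
      ultimately show ?thesis by (simp add: algebra_simps abs_le_iff)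
    qed
    then show "norm (heat_kernel t (x - y) *\<^sub>R f y - heat_kernel s (x - y) *\<^sub>R f y) \<le> ?D y"
      by (simp add: scaleR_diff_left[symmetric] mult_mono' bounded)
  qed (use int in auto)
  also have "\<dots> = 2 * C * (k - 1)"
    using integral_heat_kernel[OF t, of x] integral_heat_kernel[OF st(1), of x] by (simp add: algebra_simps)
  finally show ?thesis by (simp add: k_def)
qed

text \<open>Time, function and point all depend on the parameter \<open>w\<close>: this joint form
  yields measurability both of the integrand in the Duhamel term and of the Picard iterates on
  space-time.\<close>

lemma borel_measurable_heat_semigroup [measurable]:
  fixes f :: "'a \<Rightarrow> real ^ 'n \<Rightarrow> complex"
  assumes [measurable]: "(\<lambda>(w, y). f w y) \<in> borel_measurable (M \<Otimes>\<^sub>M borel)"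
    "\<tau> \<in> borel_measurable M" "\<xi> \<in> borel_measurable M"
  shows "(\<lambda>w. heat_semigroup (\<tau> w) (f w) (\<xi> w)) \<in> borel_measurable M"
proof -
  have eq: "heat_semigroup (\<tau> w) (f w) (\<xi> w) =
      (if \<tau> w = 0 then f w (\<xi> w) else LINT y|lborel. heat_kernel (\<tau> w) (\<xi> w - y) *\<^sub>R f w y)"
    if "w \<in> space M" for w
    using that by (intro heat_semigroup_eq_lborel) measurable
  have "(\<lambda>w. if \<tau> w = 0 then f w (\<xi> w) else LINT y|lborel. heat_kernel (\<tau> w) (\<xi> w - y) *\<^sub>R f w y)
      \<in> borel_measurable M"
    by measurable
  then show ?thesis by (subst measurable_cong[OF eq])
qed

subsection \<open>The Duhamel integral\<close>

text \<open>Keeps the Lebesgue integrals of \<open>mild_solution\<close>, so that its Duhamel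
  formula folds into this form literally; the source \<open>f\<close> is left free for
  \<open>cpow\<close>, its Borel variant or a general nonlinearity.\<close>

definition duhamel :: "(real \<Rightarrow> real ^ 'n \<Rightarrow> complex) \<Rightarrow> real \<Rightarrow> real ^ 'n \<Rightarrow> complex" where
  "duhamel f t x = (LINT s:{0..t}|lebesgue. heat_semigroup (t - s) (f s) x)"

text \<open>The endpoints \<open>0\<close> and \<open>t\<close> form a null set. Discarding
  \<open>s = t\<close> matters, since there the semigroup is point evaluation and equality almost
  everywhere in space would not suffice.\<close>

lemma duhamel_cong_AE:
  fixes f g :: "real \<Rightarrow> real ^ 'n \<Rightarrow> complex"
  assumes [measurable]: "case_prod f \<in> borel_measurable (borel \<Otimes>\<^sub>M borel)"
    and eq: "AE s in lborel. s \<in> {0<..<t} \<longrightarrow> (AE y in lborel. g s y = f s y)"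
  shows "duhamel g t x = (LINT s:{0..t}|lborel. heat_semigroup (t - s) (f s) x)"
  unfolding duhamel_def set_lebesgue_integral_def
proof (rule integral_completion_cong_AE)
  show "AE s in lborel. indicator {0..t} s *\<^sub>R heat_semigroup (t - s) (g s) x =
      indicator {0..t} s *\<^sub>R heat_semigroup (t - s) (f s) x"
    using eq AE_lborel_singleton[of 0] AE_lborel_singleton[of t]
  proof eventually_elim
    case (elim s)
    then show ?case
      by (auto simp: indicator_def heat_semigroup_cong_AE[of "t - s" "f s" "g s"]
          heat_semigroup_eq_lborel)
  qed
qed measurable

lemma duhamel_eq_lborel:
  fixes f :: "real \<Rightarrow> real ^ 'n \<Rightarrow> complex"
  assumes "case_prod f \<in> borel_measurable (borel \<Otimes>\<^sub>M borel)"
  shows "duhamel f t x = (LINT s:{0..t}|lborel. heat_semigroup (t - s) (f s) x)"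
  using assms by (rule duhamel_cong_AE) simp

text \<open>Moving the variable domain \<open>{0..t}\<close> into the integrand as a case
  distinction makes the integrand jointly measurable in \<open>w\<close> and
  \<open>s\<close>.\<close>

lemma borel_measurable_duhamel [measurable (raw)]:
  fixes f :: "real \<Rightarrow> real ^ 'n \<Rightarrow> complex"
  assumes [measurable]: "case_prod f \<in> borel_measurable (borel \<Otimes>\<^sub>M borel)"
    "\<tau> \<in> borel_measurable M" "\<xi> \<in> borel_measurable M"
  shows "(\<lambda>w. duhamel f (\<tau> w) (\<xi> w)) \<in> borel_measurable M"
proof -
  have "(\<lambda>w. LINT s|lborel. (if 0 \<le> s \<and> s \<le> \<tau> w then heat_semigroup (\<tau> w - s) (f s) (\<xi> w) else 0))
      \<in> borel_measurable M"
    by measurable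
  also have "(\<lambda>w. LINT s|lborel. (if 0 \<le> s \<and> s \<le> \<tau> w then heat_semigroup (\<tau> w - s) (f s) (\<xi> w) else 0))
      = (\<lambda>w. duhamel f (\<tau> w) (\<xi> w))"
    by (auto simp: duhamel_eq_lborel set_lebesgue_integral_def intro!: Bochner_Integration.integral_cong)
  finally show ?thesis .
qed

lemma borel_measurable_section:
  assumes "case_prod f \<in> borel_measurable (borel \<Otimes>\<^sub>M borel)"
  shows "f s \<in> borel_measurable borel"
  using measurable_compose[OF measurable_Pair1'[of s borel borel] assms] by simp

lemma set_integrable_const_Icc:
  fixes C :: real
  shows "set_integrable lborel {a..b :: real} (\<lambda>s. C)"
  by (simp add: set_integrable_def integrable_indicator_iff emeasure_lborel_Icc_eq)

lemma set_integrable_heat_semigroup: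
  fixes f :: "real \<Rightarrow> real ^ 'n \<Rightarrow> complex"
  assumes [measurable]: "case_prod f \<in> borel_measurable (borel \<Otimes>\<^sub>M borel)"
    and bounded: "\<And>s y. norm (f s y) \<le> C"
  shows "set_integrable lborel {0..t} (\<lambda>s. heat_semigroup (t - s) (f s) x)"
proof (rule set_integrable_bound)
  show "set_integrable lborel {0..t} (\<lambda>s. C)" by (rule set_integrable_const_Icc)
  show "AE s in lborel. s \<in> {0..t} \<longrightarrow> norm (heat_semigroup (t - s) (f s) x) \<le> norm C"
  proof (intro AE_I2 impI)
    fix s assume "s \<in> {0..t}"
    then have "norm (heat_semigroup (t - s) (f s) x) \<le> C"
      by (intro norm_heat_semigroup_le borel_measurable_section assms) simp
    then show "norm (heat_semigroup (t - s) (f s) x) \<le> norm C" by simp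
  qed
qed (simp add: set_borel_measurable_def)

text \<open>The semigroup is linear and contracts the supremum norm. The bound \<open>b\<close> may
  vary in time: a constant serves the Picard contraction, a power of \<open>s\<close> the uniqueness
  iteration.\<close>

lemma norm_duhamel_diff_le:
  fixes f g :: "real \<Rightarrow> real ^ 'n \<Rightarrow> complex"
  assumes f [measurable]: "case_prod f \<in> borel_measurable (borel \<Otimes>\<^sub>M borel)"
    and g [measurable]: "case_prod g \<in> borel_measurable (borel \<Otimes>\<^sub>M borel)"
    and bounded: "\<And>s y. norm (f s y) \<le> C" "\<And>s y. norm (g s y) \<le> C"
    and b: "set_integrable lborel {0..t} b"
    and le: "AE s in lborel. s \<in> {0<..<t} \<longrightarrow> (AE y in lborel. norm (f s y - g s y) \<le> b s)"
  shows "norm (duhamel f t x - duhamel g t x) \<le> (LINT s:{0..t}|lborel. b s)"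
proof -
  note int = set_integrable_heat_semigroup[OF f bounded(1)] set_integrable_heat_semigroup[OF g bounded(2)]
  have "duhamel f t x - duhamel g t x =
      (LINT s:{0..t}|lborel. heat_semigroup (t - s) (f s) x - heat_semigroup (t - s) (g s) x)"
    using int by (simp add: duhamel_eq_lborel set_integral_diff)
  also have "norm \<dots> \<le> (LINT s:{0..t}|lborel.
      norm (heat_semigroup (t - s) (f s) x - heat_semigroup (t - s) (g s) x))"
    using int by (intro set_integral_norm_bound set_integral_diff)
  also have "\<dots> \<le> (LINT s:{0..t}|lborel. b s)"
  proof (rule set_integral_mono_AE[OF set_integrable_norm[OF set_integral_diff(1)[OF int]] b])
    show "AE s\<in>{0..t} in lborel.
        norm (heat_semigroup (t - s) (f s) x - heat_semigroup (t - s) (g s) x) \<le> b s"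
      using le AE_lborel_singleton[of 0] AE_lborel_singleton[of t]
    proof eventually_elim
      case (elim s)
      show ?case
      proof
        assume "s \<in> {0..t}"
        with elim have s: "0 < t - s" "AE y in lborel. norm (f s y - g s y) \<le> b s" by auto
        have "heat_semigroup (t - s) (f s) x - heat_semigroup (t - s) (g s) x =
            heat_semigroup (t - s) (\<lambda>y. f s y - g s y) x"
          using s(1) bounded by (intro heat_semigroup_diff[where C = C]) auto
        then show "norm (heat_semigroup (t - s) (f s) x - heat_semigroup (t - s) (g s) x) \<le> b s"
          using s by (simp add: norm_heat_semigroup_le_AE)
      qed
    qed
  qed
  finally show ?thesis .
qed

lemma norm_duhamel_le:
  fixes f :: "real \<Rightarrow> real ^ 'n \<Rightarrow> complex"
  assumes "case_prod f \<in> borel_measurable (borel \<Otimes>\<^sub>M borel)" and bounded: "\<And>s y. norm (f s y) \<le> C"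
    and "0 \<le> t"
  shows "norm (duhamel f t x) \<le> C * t"
proof -
  have "C \<ge> 0" using order_trans[OF norm_ge_zero bounded] .
  moreover have "duhamel (\<lambda>s y :: real ^ 'n. 0) t x = 0"
    by (simp add: duhamel_def heat_semigroup_def set_lebesgue_integral_def cong: if_cong)
  ultimately show ?thesis
    using assms norm_duhamel_diff_le[of f "\<lambda>s y. 0" C t "\<lambda>s. C" x]
    by (simp add: set_integrable_const_Icc set_lebesgue_integral_def mult.commute)
qed

text \<open>The time axis is cut in three. Sources on \<open>{s..t}\<close> act only at the later
  time and cost \<open>C * (t - s)\<close>. On the last stretch of length \<open>d\<close> before
  \<open>s\<close> the kernel comparison degenerates, so the trivial bound \<open>2 * C\<close> is
  used. Earlier sources satisfy \<open>s - r > d\<close>, hence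
  \<open>(t - r) / (s - r) \<le> 1 + (t - s) / d\<close>. The cut \<open>d\<close> is free and is
  optimised later.\<close>

lemma norm_duhamel_time_diff_le:
  fixes f :: "real \<Rightarrow> real ^ 'n \<Rightarrow> complex"
  assumes f [measurable]: "case_prod f \<in> borel_measurable (borel \<Otimes>\<^sub>M borel)"
    and bounded: "\<And>s y. norm (f s y) \<le> C"
    and st: "0 \<le> s" "s \<le> t" and d: "0 < d"
  shows "norm (duhamel f t x - duhamel f s x)
    \<le> C * (t - s) + 2 * C * d + 2 * C * ((1 + (t - s) / d) powr (real CARD('n) / 2) - 1) * s"
proof -
  define k where "k = (1 + (t - s) / d) powr (real CARD('n) / 2) - 1"
  have k: "k \<ge> 0" using st d by (simp add: k_def ge_one_powr_ge_zero)
  have C: "C \<ge> 0" using order_trans[OF norm_ge_zero bounded] .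
  have Ck: "C * k \<ge> 0" using C k by simp
  note int = set_integrable_heat_semigroup[OF f bounded, unfolded set_integrable_def]
  have ind: "integrable lborel (\<lambda>r. indicator {a..b} r * c)" for a b c :: real
    using set_integrable_const_Icc[of a b c] by (simp only: set_integrable_def real_scaleR_def)
  let ?h = "\<lambda>t r. indicator {0..t} r *\<^sub>R heat_semigroup (t - r) (f r) x"
  \<comment> \<open>The three intervals overlap, and the middle one may reach below
    \<open>0\<close>; as all terms are nonnegative, their sum is still a majorant.\<close>
  let ?b = "\<lambda>r. indicator {s..t} r * C + indicator {s - d..s} r * (2 * C) + indicator {0..s} r * (2 * C * k)"
  have "norm (duhamel f t x - duhamel f s x) = norm (LINT r|lborel. ?h t r - ?h s r)"
    by (simp add: duhamel_eq_lborel set_lebesgue_integral_def int)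
  also have "\<dots> \<le> (LINT r|lborel. norm (?h t r - ?h s r))"
    by (rule integral_norm_bound)
  also have "\<dots> \<le> (LINT r|lborel. ?b r)"
  proof (rule integral_mono)
    fix r
    have bound: "norm (heat_semigroup (\<tau> - r) (f r) x) \<le> C" if "r \<le> \<tau>" for \<tau>
      using that by (intro norm_heat_semigroup_le borel_measurable_section assms) simp
    consider "r < 0 \<or> t < r" | "s < r" "r \<le> t" | "0 \<le> r" "s - d \<le> r" "r \<le> s" | "0 \<le> r" "r < s - d"
      by linarith
    then show "norm (?h t r - ?h s r) \<le> ?b r"
    proof cases
      case 1
      then have "?h t r - ?h s r = 0" using st by (auto simp: indicator_def)
      moreover have "0 \<le> ?b r" using C k by simp
      ultimately show ?thesis by simp
    next
      case 2
      then show ?thesis using st bound[of t] by (simp add: indicator_def)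
    next
      case 3
      have "norm (heat_semigroup (t - r) (f r) x - heat_semigroup (s - r) (f r) x) \<le> C + C"
        using 3 st bound by (intro order_trans[OF norm_triangle_ineq4] add_mono) auto
      then show ?thesis using 3 st C Ck by (cases "r = s") (auto simp: indicator_def)
    next
      case 4
      have "norm (heat_semigroup (t - r) (f r) x - heat_semigroup (s - r) (f r) x)
          \<le> 2 * C * (((t - r) / (s - r)) powr (real CARD('n) / 2) - 1)"
        using 4 st d by (intro norm_heat_semigroup_time_diff_le borel_measurable_section assms) simp_all
      also have "\<dots> \<le> 2 * C * k"
      proof -
        have "(t - r) / (s - r) = 1 + (t - s) / (s - r)" using 4 d by (simp add: field_simps)
        also have "\<dots> \<le> 1 + (t - s) / d" using 4 d st by (simp add: frac_le)
        finally show ?thesis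
          unfolding k_def using 4 st d C by (intro mult_left_mono diff_right_mono powr_mono2) auto
      qed
      finally show ?thesis using 4 st d by (simp add: indicator_def)
    qed
  qed (intro integrable_norm Bochner_Integration.integrable_diff Bochner_Integration.integrable_add int ind)+
  also have "\<dots> = C * (t - s) + 2 * C * d + 2 * C * k * s"
    using st d by (simp add: algebra_simps)
  finally show ?thesis by (simp add: k_def)
qed

subsection \<open>The power on the half-plane\<close>

text \<open>On the right half-plane the principal argument lies strictly between
  \<open>- pi / 2\<close> and \<open>pi / 2\<close>, where \<open>arcsin\<close> inverts
  \<open>sin\<close>.\<close>

lemma arg_half_eq_Im_Ln:
  assumes "Re z > 0"
  shows "arg_half (Re z) (Im z) = Im (Ln z)"
proof -
  have z: "z \<noteq> 0" using assms by auto
  have "Im (exp (Ln z)) = norm z * sin (Im (Ln z))"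
    using z by (simp only: Im_exp Re_Ln) simp
  then have "Im z = norm z * sin (Im (Ln z))" using z by simp
  then have "sin (Im (Ln z)) = Im z / norm z" using z by (simp add: field_simps)
  moreover have "\<bar>Im (Ln z)\<bar> < pi / 2" using assms by (rule Re_Ln_pos_lt_imp)
  ultimately show ?thesis
    using arcsin_sin[of "Im (Ln z)"] by (simp add: arg_half_def cmod_def abs_less_iff)
qed

text \<open>Extended by \<open>0\<close> so as to be Borel everywhere; solutions satisfy \<open>Re u > 0\<close> only almost everywhere.\<close>

definition halfpow :: "real \<Rightarrow> complex \<Rightarrow> complex" where
  "halfpow p z = indicator {z. Re z > 0} z *\<^sub>R (z powr of_real p)"

text \<open>The explicit polar formula is the principal branch of the power, so the holomorphic
  calculus of \<open>powr\<close> becomes available.\<close>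

lemma halfpow_eq_cpow:
  assumes "Re z > 0"
  shows "halfpow p z = cpow p z"
proof -
  have z: "z \<noteq> 0" using assms by auto
  have "z powr of_real p = exp (of_real p * Ln z)" using z by (simp add: powr_def)
  also have "\<dots> = of_real (exp (p * ln (norm z))) * cis (p * Im (Ln z))"
    using z by (simp add: exp_eq_polar)
  also have "exp (p * ln (norm z)) = norm z powr p" using z by (simp add: powr_def)
  finally show ?thesis
    using assms by (simp add: halfpow_def cpow_def arg_half_eq_Im_Ln complex_eq_iff)
qed

lemma not_nonpos_Reals_if_Re_pos: "Re z > 0 \<Longrightarrow> z \<notin> \<real>\<^sub>\<le>\<^sub>0"
  by (simp add: complex_nonpos_Reals_iff)

lemma borel_measurable_halfpow [measurable]: "halfpow p \<in> borel_measurable borel"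
  unfolding halfpow_def[abs_def]
proof (rule borel_measurable_continuous_on_indicator)
  show "continuous_on {z. Re z > 0} (\<lambda>z. z powr of_real p)"
    by (intro continuous_on_powr_complex continuous_intros) (auto simp: complex_nonpos_Reals_iff)
qed (simp add: open_halfspace_Re_gt)

lemma norm_halfpow_le:
  assumes "p \<ge> 0" "norm z \<le> B"
  shows "norm (halfpow p z) \<le> B powr p"
  using assms by (auto simp: halfpow_def indicator_def norm_powr_real_powr' intro: powr_mono2)

text \<open>Since \<open>p - 1 \<ge> 0\<close>, the derivative stays bounded up to the imaginary
  axis and the constant depends on \<open>B\<close> only. Uniqueness relies on this, because a
  competing solution is known only to have positive real part.\<close>

lemma norm_halfpow_diff_le:
  assumes p: "p \<ge> 1" and z: "Re z > 0" "norm z \<le> B" and w: "Re w > 0" "norm w \<le> B"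
  shows "norm (halfpow p z - halfpow p w) \<le> p * B powr (p - 1) * norm (z - w)"
proof -
  let ?S = "{z. Re z > 0} \<inter> cball 0 B"
  have "norm (z powr of_real p - w powr of_real p) \<le> p * B powr (p - 1) * norm (z - w)"
  proof (rule field_differentiable_bound)
    show "convex ?S" by (intro convex_Int convex_halfspace_Re_gt convex_cball)
    fix v assume v: "v \<in> ?S"
    then show "((\<lambda>z. z powr of_real p) has_field_derivative of_real p * v powr (of_real p - 1)) (at v within ?S)"
      by (simp add: has_field_derivative_at_within[OF has_field_derivative_powr] not_nonpos_Reals_if_Re_pos)
    have "norm (v powr (of_real p - 1)) = norm v powr (p - 1)"
      using norm_powr_real_powr'[of "of_real (p - 1)" v] by simp
    also have "\<dots> \<le> B powr (p - 1)" using v p by (intro powr_mono2) auto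
    finally show "norm (of_real p * v powr (of_real p - 1)) \<le> p * B powr (p - 1)"
      using p by (simp add: norm_mult mult_left_mono)
  qed (use z w in auto)
  then show ?thesis using z w by (simp add: halfpow_def)
qed

subsection \<open>Existence by Picard iteration\<close>

text \<open>The quantitative part of the Banach fixed point argument, to be applied at each point
  \<open>(t, x)\<close> with the same \<open>D\<close>. The limit is thus uniform, and its
  measurability comes from pointwise convergence.\<close>

lemma geometric_limit:
  fixes X :: "nat \<Rightarrow> 'a :: banach"
  assumes step: "\<And>k. norm (X (Suc k) - X k) \<le> D * (1 / 2) ^ k"
  shows "convergent X" and "norm (lim X - X k) \<le> 2 * D * (1 / 2) ^ k"
proof -
  have "summable (\<lambda>k. X (Suc k) - X k)"
    using step by (intro summable_comparison_test'[OF summable_mult[OF summable_geometric]]) auto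
  then have "convergent (\<lambda>n. \<Sum>k<n. X (Suc k) - X k)"
    by (rule summable_iff_convergent[THEN iffD1])
  then have "convergent (\<lambda>n. X n - X 0 + X 0)"
    unfolding sum_lessThan_telescope by (intro convergent_add convergent_const)
  then show conv: "convergent X" by simp
  have "D \<ge> 0" using order_trans[OF norm_ge_zero step[of 0]] by simp
  \<comment> \<open>The last factor is the exact partial sum of the geometric series; the weaker
    factor 2 would not pass through the induction.\<close>
  have dist: "norm (X (k + m) - X k) \<le> D * (1 / 2) ^ k * (2 - 2 * (1 / 2) ^ m)" for m
  proof (induction m)
    case (Suc m)
    have "norm (X (k + Suc m) - X k) \<le> norm (X (Suc (k + m)) - X (k + m)) + norm (X (k + m) - X k)"
      using norm_triangle_ineq[of "X (Suc (k + m)) - X (k + m)" "X (k + m) - X k"] by simp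
    also have "\<dots> \<le> D * (1 / 2) ^ (k + m) + D * (1 / 2) ^ k * (2 - 2 * (1 / 2) ^ m)"
      using Suc step by (rule add_mono[rotated])
    also have "\<dots> = D * (1 / 2) ^ k * (2 - 2 * (1 / 2) ^ Suc m)"
      by (simp add: power_add algebra_simps)
    finally show ?case .
  qed simp
  have "norm (X (m + k) - X k) \<le> 2 * D * (1 / 2) ^ k" for m
  proof -
    have "D * (1 / 2) ^ k * (2 - 2 * (1 / 2) ^ m) \<le> D * (1 / 2) ^ k * 2"
      using \<open>D \<ge> 0\<close> by (intro mult_left_mono) auto
    then show ?thesis using dist[of m] by (simp add: add.commute)
  qed
  moreover have "(\<lambda>m. norm (X (m + k) - X k)) \<longlonglongrightarrow> norm (lim X - X k)"
    using conv by (intro tendsto_intros LIMSEQ_ignore_initial_segment) (simp add: convergent_LIMSEQ_iff)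
  ultimately show "norm (lim X - X k) \<le> 2 * D * (1 / 2) ^ k"
    by (intro LIMSEQ_le_const2) auto
qed

text \<open>Picard iteration for a general nonlinearity. The Duhamel term has norm at most
  \<open>C * T\<close>, so \<open>C * T \<le> l - r\<close> and \<open>C * T \<le> B - M\<close>
  keep the iterates in \<open>K\<close>, while \<open>L * T \<le> 1 / 2\<close> is the contraction
  factor.\<close>

lemma ex_mild_fixed_point:
  fixes w :: "real ^ 'n \<Rightarrow> complex" and \<Phi> :: "complex \<Rightarrow> complex"
  assumes K: "K = {z. r \<le> Re z \<and> norm z \<le> B}"
    and [measurable]: "\<Phi> \<in> borel_measurable borel" "w \<in> borel_measurable borel"
    and w: "\<And>x. l \<le> Re (w x)" "\<And>x. norm (w x) \<le> M"
    and bound: "\<And>z. z \<in> K \<Longrightarrow> norm (\<Phi> z) \<le> C"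
    and lipschitz: "\<And>z z'. z \<in> K \<Longrightarrow> z' \<in> K \<Longrightarrow> norm (\<Phi> z - \<Phi> z') \<le> L * norm (z - z')"
    and L: "0 \<le> L" "L * T \<le> 1 / 2" and C: "0 \<le> C" "C * T \<le> l - r" "C * T \<le> B - M" and T: "0 \<le> T"
  shows "\<exists>u :: real \<Rightarrow> real ^ 'n \<Rightarrow> complex. case_prod u \<in> borel_measurable (borel \<Otimes>\<^sub>M borel) \<and> (\<forall>t x. u t x \<in> K) \<and>
    (\<forall>t\<in>{0..T}. \<forall>x. u t x = heat_semigroup t w x + duhamel (\<lambda>s y. \<Phi> (u s y)) t x)"
proof -
  define admissible where
    "admissible u \<longleftrightarrow> case_prod u \<in> borel_measurable (borel \<Otimes>\<^sub>M borel) \<and> (\<forall>t x. u t x \<in> K)"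
    for u :: "real \<Rightarrow> real ^ 'n \<Rightarrow> complex"
  \<comment> \<open>Outside \<open>{0..T}\<close> the value \<open>w x\<close> keeps the iterates
    Borel and in \<open>K\<close> at all times, so the estimates above, which ask for global bounds,
    apply directly.\<close>
  define S where "S u t x = (if 0 \<le> t \<and> t \<le> T
      then heat_semigroup t w x + duhamel (\<lambda>s y. \<Phi> (u s y)) t x else w x)"
    for u :: "real \<Rightarrow> real ^ 'n \<Rightarrow> complex" and t x
  have CT: "0 \<le> C * T" using C T by simp
  have wK: "w x \<in> K" for x using w[of x] C CT by (auto simp: K)
  have source [measurable]: "(\<lambda>(s, y). \<Phi> (u s y)) \<in> borel_measurable (borel \<Otimes>\<^sub>M borel)"
    and source_le: "\<And>s y. norm (\<Phi> (u s y)) \<le> C" if "admissible u" for u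
  proof -
    have [measurable]: "case_prod u \<in> borel_measurable (borel \<Otimes>\<^sub>M borel)"
      using that by (simp add: admissible_def)
    show "(\<lambda>(s, y). \<Phi> (u s y)) \<in> borel_measurable (borel \<Otimes>\<^sub>M borel)" by measurable
    show "norm (\<Phi> (u s y)) \<le> C" for s y using that by (simp add: admissible_def bound)
  qed
  have admissible_S: "admissible (S u)" if u: "admissible u" for u
    unfolding admissible_def
  proof (intro conjI allI)
    note [measurable] = source[OF u]
    show "case_prod (S u) \<in> borel_measurable (borel \<Otimes>\<^sub>M borel)"
      unfolding S_def[abs_def] by measurable
    fix t x
    show "S u t x \<in> K"
    proof (cases "0 \<le> t \<and> t \<le> T")
      case True
      let ?D = "duhamel (\<lambda>s y. \<Phi> (u s y)) t x"
      have "norm ?D \<le> C * t"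
        using source[OF u] source_le[OF u] True by (intro norm_duhamel_le) auto
      also have "\<dots> \<le> C * T" using True C by (simp add: mult_left_mono)
      finally have D: "norm ?D \<le> C * T" .
      have "l \<le> Re (heat_semigroup t w x)"
        using True w by (intro Re_heat_semigroup_ge[where C = M]) auto
      moreover have "norm (heat_semigroup t w x) \<le> M"
        using True w by (intro norm_heat_semigroup_le) auto
      ultimately show ?thesis
        using D C abs_Re_le_cmod[of ?D] norm_triangle_ineq[of "heat_semigroup t w x" ?D] True
        by (simp add: K S_def)
    qed (use wK in \<open>auto simp: S_def\<close>)
  qed
  have contraction: "norm (S u t x - S v t x) \<le> e / 2"
    if u: "admissible u" and v: "admissible v" and e: "\<And>t x. norm (u t x - v t x) \<le> e" for u v e t x
  proof -
    have "0 \<le> e" using order_trans[OF norm_ge_zero e] .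
    show ?thesis
    proof (cases "0 \<le> t \<and> t \<le> T")
      case True
      have Lip: "norm (\<Phi> (u s y) - \<Phi> (v s y)) \<le> L * e" for s y
        using u v e L by (intro order_trans[OF lipschitz] mult_left_mono) (auto simp: admissible_def)
      have "norm (duhamel (\<lambda>s y. \<Phi> (u s y)) t x - duhamel (\<lambda>s y. \<Phi> (v s y)) t x)
          \<le> (LINT s:{0..t}|lborel. L * e)"
        using source[OF u] source[OF v] source_le[OF u] source_le[OF v]
        by (rule norm_duhamel_diff_le) (simp_all add: set_integrable_const_Icc Lip)
      also have "\<dots> = e * (L * t)"
        using True by (simp add: set_lebesgue_integral_def mult_ac)
      also have "\<dots> \<le> e * (1 / 2)"
        using True L \<open>0 \<le> e\<close> mult_left_mono[of t T L] by (intro mult_left_mono) auto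
      finally show ?thesis using True by (simp add: S_def)
    qed (use \<open>0 \<le> e\<close> in \<open>auto simp: S_def\<close>)
  qed
  define U where "U k = (S ^^ k) (\<lambda>t. w)" for k
  have U_Suc: "U (Suc k) = S (U k)" for k by (simp add: U_def)
  have U: "admissible (U k)" for k
  proof (induction k)
    case 0
    show ?case using wK by (simp add: U_def admissible_def)
  qed (simp add: U_Suc admissible_S)
  have step: "norm (U (Suc k) t x - U k t x) \<le> 2 * B * (1 / 2) ^ k" for k t x
  proof (induction k arbitrary: t x)
    case 0
    have "norm (U 1 t x) \<le> B" "norm (U 0 t x) \<le> B"
      using U[of 1] U[of 0] by (auto simp: admissible_def K)
    then show ?case
      using norm_triangle_ineq4[of "U 1 t x" "U 0 t x"] by simp
  next
    case (Suc k)
    then show ?case using contraction[OF U U Suc.IH] by (simp add: U_Suc)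
  qed
  define u where "u t x = lim (\<lambda>k. U k t x)" for t x
  have conv: "(\<lambda>k. U k t x) \<longlonglongrightarrow> u t x" for t x
    using geometric_limit(1)[of "\<lambda>k. U k t x", OF step] by (simp add: u_def convergent_LIMSEQ_iff)
  have dist: "norm (u t x - U k t x) \<le> 4 * B * (1 / 2) ^ k" for k t x
    using geometric_limit(2)[of "\<lambda>k. U k t x", OF step] by (simp add: u_def)
  have u: "admissible u"
    unfolding admissible_def
  proof (intro conjI allI)
    have "(\<lambda>z. U k (fst z) (snd z)) \<in> borel_measurable (borel \<Otimes>\<^sub>M borel)" for k
      using U[of k] by (simp add: admissible_def case_prod_beta')
    then show "case_prod u \<in> borel_measurable (borel \<Otimes>\<^sub>M borel)"
      unfolding u_def case_prod_beta' by (rule borel_measurable_lim_metric)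
    have "K = {z. r \<le> Re z} \<inter> cball 0 B" by (auto simp: K)
    then have "closed K" by (simp add: closed_Int closed_halfspace_Re_ge)
    then show "u t x \<in> K" for t x
      using U conv by (intro Lim_in_closed_set[OF _ _ _ conv]) (auto simp: admissible_def)
  qed
  have "u t x = S u t x" for t x
  proof -
    \<comment> \<open>Both \<open>u\<close> and \<open>S u\<close> are compared with the iterate
      \<open>U (Suc k) = S (U k)\<close>; each distance contributes half of the bound.\<close>
    have "norm (u t x - S u t x) \<le> 4 * B * (1 / 2) ^ k" for k
    proof -
      have "norm (S (U k) t x - S u t x) \<le> 4 * B * (1 / 2) ^ k / 2"
        using dist by (intro contraction[OF U u]) (simp add: norm_minus_commute)
      moreover have "norm (u t x - S (U k) t x) \<le> 4 * B * (1 / 2) ^ Suc k"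
        using dist[of t x "Suc k"] by (simp add: U_Suc)
      ultimately show ?thesis
        using norm_triangle_ineq[of "u t x - S (U k) t x" "S (U k) t x - S u t x"] by simp
    qed
    moreover have "(\<lambda>k. 4 * B * (1 / 2) ^ k) \<longlonglongrightarrow> 0"
      by (intro tendsto_mult_right_zero LIMSEQ_realpow_zero) auto
    ultimately have "norm (u t x - S u t x) \<le> 0" by (intro LIMSEQ_le_const) auto
    then show ?thesis by simp
  qed
  then have "\<forall>t\<in>{0..T}. \<forall>x. u t x = heat_semigroup t w x + duhamel (\<lambda>s y. \<Phi> (u s y)) t x"
    by (simp add: S_def)
  with u show ?thesis by (auto simp: admissible_def)
qed

subsection \<open>Uniqueness\<close>

lemma completion_ex_borel_measurable_complex:
  fixes f :: "'a \<Rightarrow> complex"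
  assumes f: "f \<in> borel_measurable (completion M)"
  shows "\<exists>g\<in>borel_measurable M. AE x in M. f x = g x"
proof -
  have Re: "(\<lambda>x. Re (f x)) \<in> borel_measurable (completion M)"
    and Im: "(\<lambda>x. Im (f x)) \<in> borel_measurable (completion M)"
    using f by measurable
  obtain a where [measurable]: "a \<in> borel_measurable M" and a: "AE x in M. Re (f x) = a x"
    using completion_ex_borel_measurable_real[OF Re] by blast
  obtain b where [measurable]: "b \<in> borel_measurable M" and b: "AE x in M. Im (f x) = b x"
    using completion_ex_borel_measurable_real[OF Im] by blast
  have "AE x in M. f x = of_real (a x) + \<i> * of_real (b x)"
    using a b by eventually_elim (simp add: complex_eq_iff)
  moreover have "(\<lambda>x. of_real (a x) + \<i> * of_real (b x) :: complex) \<in> borel_measurable M"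
    by measurable
  ultimately show ?thesis by (rule bexI)
qed

lemma Linfty_norm_le:
  assumes [measurable]: "f \<in> borel_measurable M" and "AE x in M. norm (f x) \<le> B"
  shows "Linfty_norm M f \<le> ereal B"
  unfolding Linfty_norm_def
proof (rule esssup_I)
  show "AE x in M. ereal (norm (f x)) \<le> ereal B" using assms(2) by simp
qed measurable

lemma LinftyI:
  assumes "f \<in> borel_measurable M" "AE x in M. norm (f x) \<le> B"
  shows "f \<in> Linfty M"
proof -
  have "Linfty_norm M f < \<infinity>" by (rule le_less_trans[OF Linfty_norm_le[OF assms]]) simp
  with assms(1) show ?thesis by (simp add: Linfty_def)
qed

lemma Linfty_AE_bounded:
  assumes "f \<in> Linfty M"
  shows "\<exists>B. AE x in M. norm (f x) \<le> B"
proof -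
  have "Linfty_norm M f < \<infinity>" using assms by (simp add: Linfty_def)
  then obtain n :: nat where "Linfty_norm M f < ereal (real n)"
    using less_PInf_Ex_of_nat[of "Linfty_norm M f"] by auto
  then have "AE x in M. norm (f x) \<le> real n"
    using esssup_AE[of "\<lambda>x. ereal (norm (f x))" M]
    by (auto simp: Linfty_norm_def elim!: eventually_mono dest: le_less_trans)
  then show ?thesis ..
qed

text \<open>Joint measurability on the space-time slab gives a Borel function equal to
  \<open>v\<close> almost everywhere there, and Fubini turns this into equality in space for almost
  every time. The values on the remaining null set are then repaired so that boundedness and
  positivity hold at every point.\<close>

lemma mild_solution_borel_representative:
  fixes v :: "real \<Rightarrow> real ^ 'n \<Rightarrow> complex"
  assumes "mild_solution p u\<^sub>0 T v"
  obtains v' B where "case_prod v' \<in> borel_measurable (borel \<Otimes>\<^sub>M borel)"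
    "\<And>s y. norm (v' s y) \<le> B" "\<And>s y. Re (v' s y) > 0"
    "AE s in lborel. s \<in> {0<..<T} \<longrightarrow> (AE y in lborel. v s y = v' s y)"
proof -
  let ?S = "{0<..<T} \<times> (UNIV :: (real ^ 'n) set)"
  have S: "?S \<in> sets borel" by (intro borel_open open_Times) auto
  have pos: "AE y in lborel. Re (v s y) > 0" if "s \<in> {0<..<T}" for s
    using assms that by (auto simp: mild_solution_def AE_completion_iff)
  have v: "case_prod v \<in> Linfty (lebesgue_on ?S)"
    using assms by (auto simp: mild_solution_def)
  \<comment> \<open>Extension by zero turns measurability on the slab into Lebesgue measurability on
    the whole space.\<close>
  have "(\<lambda>z. indicator ?S z *\<^sub>R case_prod v z) \<in> borel_measurable lebesgue"
    using v S by (simp add: Linfty_def borel_measurable_restrict_space_iff)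
  then obtain g where [measurable]: "g \<in> borel_measurable lborel"
    and g: "AE z in lborel. indicator ?S z *\<^sub>R case_prod v z = g z"
    using completion_ex_borel_measurable_complex by blast
  obtain B where "AE z in lebesgue_on ?S. norm (case_prod v z) \<le> B"
    using Linfty_AE_bounded[OF v] by blast
  then have "AE z in lborel. z \<in> ?S \<longrightarrow> norm (case_prod v z) \<le> B"
    using S by (simp add: AE_restrict_space_iff AE_completion_iff)
  with g have "AE z in lborel \<Otimes>\<^sub>M lborel. z \<in> ?S \<longrightarrow> case_prod v z = g z \<and> norm (g z) \<le> B"
    unfolding lborel_prod by eventually_elim auto
  then have ae: "AE s in lborel. AE y in lborel. (s, y) \<in> ?S \<longrightarrow> v s y = g (s, y) \<and> norm (g (s, y)) \<le> B"
    using lborel_pair.AE_pair by fastforce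
  have [measurable]: "g \<in> borel_measurable (borel \<Otimes>\<^sub>M borel)"
    using \<open>g \<in> borel_measurable lborel\<close> by (simp add: borel_prod)
  \<comment> \<open>The default \<open>1\<close> lies in the half-plane and has norm 1, which is why
    the final bound is \<open>max 1 B\<close>.\<close>
  define v' where "v' s y = (if Re (g (s, y)) > 0 \<and> norm (g (s, y)) \<le> B then g (s, y) else 1)" for s y
  show thesis
  proof
    show "case_prod v' \<in> borel_measurable (borel \<Otimes>\<^sub>M borel)"
      unfolding v'_def[abs_def] by measurable
    show "norm (v' s y) \<le> max 1 B" "Re (v' s y) > 0" for s y
      by (auto simp: v'_def)
    show "AE s in lborel. s \<in> {0<..<T} \<longrightarrow> (AE y in lborel. v s y = v' s y)"
      using ae
    proof eventually_elim
      case (elim s)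
      show ?case
      proof
        assume s: "s \<in> {0<..<T}"
        show "AE y in lborel. v s y = v' s y"
          using elim pos[OF s] by eventually_elim (use s in \<open>auto simp: v'_def\<close>)
      qed
    qed
  qed
qed

lemma duhamel_cpow_cong_AE:
  fixes v v' :: "real \<Rightarrow> real ^ 'n \<Rightarrow> complex"
  assumes [measurable]: "case_prod v' \<in> borel_measurable (borel \<Otimes>\<^sub>M borel)"
    and pos: "\<And>s y. Re (v' s y) > 0"
    and ae: "AE s in lborel. s \<in> {0<..<t} \<longrightarrow> (AE y in lborel. v s y = v' s y)"
  shows "duhamel (\<lambda>s y. cpow p (v s y)) t x = duhamel (\<lambda>s y. halfpow p (v' s y)) t x"
proof -
  have [measurable]: "(\<lambda>(s, y). halfpow p (v' s y)) \<in> borel_measurable (borel \<Otimes>\<^sub>M borel)"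
    by measurable
  have "AE s in lborel. s \<in> {0<..<t} \<longrightarrow> (AE y in lborel. cpow p (v s y) = halfpow p (v' s y))"
    using ae by eventually_elim (auto simp: halfpow_eq_cpow[OF pos] elim: eventually_mono)
  then show ?thesis by (simp add: duhamel_cong_AE duhamel_eq_lborel)
qed

text \<open>One round of the iterated Gronwall argument: integrating \<open>L\<close> times the
  \<open>k\<close>-th majorant yields the next one.\<close>

lemma set_integral_power_fact:
  fixes L t D :: real
  assumes "0 \<le> t"
  shows "set_integrable lborel {0..t} (\<lambda>s. L * (D * (L * s) ^ k / fact k))"
    and "(LINT s:{0..t}|lborel. L * (D * (L * s) ^ k / fact k)) = D * (L * t) ^ Suc k / fact (Suc k)"
proof -
  let ?F = "\<lambda>s. D * (L * s) ^ Suc k / fact (Suc k)"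
  have "has_bochner_integral lborel
      (\<lambda>s. indicator {0..t} s *\<^sub>R (L * (D * (L * s) ^ k / fact k))) (?F t - ?F 0)"
    unfolding real_scaleR_def mult.commute[of "indicator _ _"]
  proof (rule has_bochner_integral_FTC_Icc_real[OF assms])
    fix s :: real
    have "(?F has_real_derivative D * (real (Suc k) * (L * s) ^ k * L) / fact (Suc k)) (at s)"
      by (auto intro!: derivative_eq_intros simp del: power_Suc)
    also have "D * (real (Suc k) * (L * s) ^ k * L) / fact (Suc k) = L * (D * (L * s) ^ k / fact k)"
      by (simp add: mult_ac del: of_nat_Suc)
    finally show "(?F has_real_derivative L * (D * (L * s) ^ k / fact k)) (at s)" .
    show "isCont (\<lambda>s. L * (D * (L * s) ^ k / fact k)) s" by (intro continuous_intros) auto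
  qed
  moreover have "?F t - ?F 0 = ?F t" by simp
  ultimately show "set_integrable lborel {0..t} (\<lambda>s. L * (D * (L * s) ^ k / fact k))"
    "(LINT s:{0..t}|lborel. L * (D * (L * s) ^ k / fact k)) = ?F t"
    unfolding has_bochner_integral_iff set_integrable_def set_lebesgue_integral_def by metis+
qed

text \<open>The Lipschitz constant depends on the bound of the competing solution, so no smallness of \<open>T\<close>
  is available here; iterating the Duhamel estimate gains a factor \<open>L * t / k\<close> at the \<open>k\<close>-th step.\<close>

lemma mild_solution_unique:
  fixes u v :: "real \<Rightarrow> real ^ 'n \<Rightarrow> complex"
  assumes p: "p \<ge> 1" and mild: "mild_solution p u\<^sub>0 T v"
    and u0: "AE x in lborel. u\<^sub>0 x = w x" and [measurable]: "w \<in> borel_measurable borel"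
    and [measurable]: "case_prod u \<in> borel_measurable (borel \<Otimes>\<^sub>M borel)"
    and u: "\<And>s y. norm (u s y) \<le> M" "\<And>s y. Re (u s y) > 0"
    and fixed: "\<And>t x. t \<in> {0..T} \<Longrightarrow>
      u t x = heat_semigroup t w x + duhamel (\<lambda>s y. halfpow p (u s y)) t x"
    and t: "t \<in> {0..T}"
  shows "AE x in lborel. v t x = u t x"
proof -
  obtain v' B where [measurable]: "case_prod v' \<in> borel_measurable (borel \<Otimes>\<^sub>M borel)"
    and v': "\<And>s y. norm (v' s y) \<le> B" "\<And>s y. Re (v' s y) > 0"
      "AE s in lborel. s \<in> {0<..<T} \<longrightarrow> (AE y in lborel. v s y = v' s y)"
    using mild_solution_borel_representative[OF mild] by blast
  let ?V = "\<lambda>s y. halfpow p (v' s y)" and ?U = "\<lambda>s y. halfpow p (u s y)"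
  \<comment> \<open>The Duhamel integral sees only almost every time and can be written with
    \<open>v'\<close>, while the left side keeps \<open>v t\<close> itself. Equality of the two
    Duhamel integrals therefore settles every \<open>t\<close>, including times at which
    \<open>v t\<close> and \<open>v' t\<close> differ.\<close>
  have V: "AE x in lborel. v t x = heat_semigroup t w x + duhamel ?V t x" if t: "t \<in> {0..T}" for t
  proof -
    have ae: "AE s in lborel. s \<in> {0<..<t} \<longrightarrow> (AE y in lborel. v s y = v' s y)"
      using v'(3) t by (auto elim!: eventually_mono)
    have "AE x in lborel. v t x = heat_semigroup t u\<^sub>0 x + duhamel (\<lambda>s y. cpow p (v s y)) t x"
      using mild t by (simp add: mild_solution_def duhamel_def AE_completion_iff)
    then show ?thesis
      using u0
    proof eventually_elim
      case (elim x)
      have "heat_semigroup t u\<^sub>0 x = heat_semigroup t w x"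
        using u0 elim(2) by (intro heat_semigroup_eq_if_AE_eq) auto
      then show ?case using elim(1) v'(2) ae by (simp add: duhamel_cpow_cong_AE)
    qed
  qed
  define N where "N = max M B"
  define C where "C = N powr p"
  define L where "L = p * N powr (p - 1)"
  have L: "0 \<le> L" using p by (simp add: L_def)
  have N: "norm (u s y) \<le> N" "norm (v' s y) \<le> N" for s y
    using u(1)[of s y] v'(1)[of s y] by (auto simp: N_def)
  have C: "norm (?U s y) \<le> C" "norm (?V s y) \<le> C" for s y
    using p N by (auto simp: C_def intro!: norm_halfpow_le)
  have [measurable]: "case_prod ?U \<in> borel_measurable (borel \<Otimes>\<^sub>M borel)"
    "case_prod ?V \<in> borel_measurable (borel \<Otimes>\<^sub>M borel)"
    by measurable
  have iterate: "norm (duhamel ?V t x - duhamel ?U t x) \<le> 2 * C * T * (L * t) ^ k / fact k"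
    if "t \<in> {0..T}" for k t x
    using that
  proof (induction k arbitrary: t x)
    case 0
    have "C * t \<le> C * T"
      using 0 order_trans[OF norm_ge_zero C(1)] by (intro mult_left_mono) auto
    moreover have "norm (duhamel ?V t x) \<le> C * t" "norm (duhamel ?U t x) \<le> C * t"
      using 0 C by (auto intro!: norm_duhamel_le)
    ultimately show ?case
      using norm_triangle_ineq4[of "duhamel ?V t x" "duhamel ?U t x"] by simp
  next
    case (Suc k)
    let ?b = "\<lambda>s. L * (2 * C * T * (L * s) ^ k / fact k)"
    have t: "0 \<le> t" "t \<le> T" using Suc.prems by auto
    have "norm (duhamel ?V t x - duhamel ?U t x) \<le> (LINT s:{0..t}|lborel. ?b s)"
    proof (rule norm_duhamel_diff_le)
      show "AE s in lborel. s \<in> {0<..<t} \<longrightarrow> (AE y in lborel. norm (?V s y - ?U s y) \<le> ?b s)"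
        using v'(3)
      proof eventually_elim
        case (elim s)
        show ?case
        proof
          assume "s \<in> {0<..<t}"
          then have s: "s \<in> {0<..<T}" "s \<in> {0..T}" using t by auto
          with elim have "AE y in lborel. v s y = v' s y" by simp
          then show "AE y in lborel. norm (?V s y - ?U s y) \<le> ?b s"
            using V[OF s(2)]
          proof eventually_elim
            case (elim y)
            \<comment> \<open>For almost every \<open>s\<close> the representative satisfies the
              Duhamel formula too; subtracting the formula for \<open>u\<close> cancels the free
              evolution and makes the induction hypothesis applicable.\<close>
            have "v' s y = heat_semigroup s w y + duhamel ?V s y" using elim by metis
            then have diff: "v' s y - u s y = duhamel ?V s y - duhamel ?U s y"
              using fixed[OF s(2), of y] by simp
            have "norm (?V s y - ?U s y) \<le> L * norm (v' s y - u s y)"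
              unfolding L_def using p u v' N by (intro norm_halfpow_diff_le) auto
            also have "\<dots> \<le> ?b s"
              unfolding diff using Suc.IH[OF s(2)] L by (intro mult_left_mono) auto
            finally show ?case .
          qed
        qed
      qed
    qed (use C set_integral_power_fact(1)[OF t(1)] in auto)
    also have "\<dots> = 2 * C * T * (L * t) ^ Suc k / fact (Suc k)"
      by (rule set_integral_power_fact(2)[OF t(1)])
    finally show ?case .
  qed
  have "duhamel ?V t x = duhamel ?U t x" for x
  proof -
    \<comment> \<open>Up to the constant, the bounds are the terms of the exponential series, so
      they tend to 0.\<close>
    have "(\<lambda>k. 2 * C * T * (inverse (fact k) * (L * t) ^ k)) \<longlonglongrightarrow> 0"
      by (intro tendsto_mult_right_zero summable_LIMSEQ_zero summable_exp)
    then have "norm (duhamel ?V t x - duhamel ?U t x) \<le> 0"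
      using iterate[OF t] by (intro LIMSEQ_le_const) (auto simp: field_simps)
    then show ?thesis by simp
  qed
  then show ?thesis using V[OF t] fixed[OF t] by simp
qed

subsection \<open>Continuity in time\<close>

text \<open>A squeeze argument. Positive total measure provides the lower bound: on a null space the
  essential supremum in \<open>ereal\<close> would be minus infinity.\<close>

lemma tendsto_Linfty_norm_zero:
  assumes meas: "\<And>s. f s \<in> borel_measurable M" and M: "emeasure M (space M) \<noteq> 0"
    and bound: "eventually (\<lambda>s. \<forall>x. norm (f s x) \<le> \<omega> s) F" and "(\<omega> \<longlongrightarrow> 0) F"
  shows "((\<lambda>s. Linfty_norm M (f s)) \<longlongrightarrow> 0) F"
proof (rule tendsto_sandwich)
  have "0 \<le> Linfty_norm M (f s)" for s
    using esssup_mono[of "\<lambda>x. 0 :: ereal" M "\<lambda>x. ereal (norm (f s x))"] M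
    by (simp add: Linfty_norm_def esssup_const)
  then show "eventually (\<lambda>s. 0 \<le> Linfty_norm M (f s)) F" by simp
  show "eventually (\<lambda>s. Linfty_norm M (f s) \<le> ereal (\<omega> s)) F"
    using bound by eventually_elim (auto intro!: Linfty_norm_le meas)
  show "((\<lambda>s. ereal (\<omega> s)) \<longlongrightarrow> 0) F"
    using assms(4) by (simp add: zero_ereal_def)
qed simp

lemma mild_solution_continuous:
  fixes u :: "real \<Rightarrow> real ^ 'n \<Rightarrow> complex"
  assumes [measurable]: "case_prod u \<in> borel_measurable (borel \<Otimes>\<^sub>M borel)"
    and f: "case_prod f \<in> borel_measurable (borel \<Otimes>\<^sub>M borel)" "\<And>s y. norm (f s y) \<le> C"
    and w: "w \<in> borel_measurable borel" "\<And>x. norm (w x) \<le> M"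
    and B: "\<And>s y. norm (u s y) \<le> B"
    and fixed: "\<And>t x. t \<in> {0..T} \<Longrightarrow> u t x = heat_semigroup t w x + duhamel f t x"
  shows "continuous_on_Linfty {0<..T} u"
proof -
  have meas: "u s \<in> borel_measurable lebesgue" for s
    using borel_measurable_section[of u s] by (simp add: measurable_completion)
  define q where "q = real CARD('n) / 2"
  \<comment> \<open>The cut \<open>d = sqrt (t - s)\<close> makes \<open>d\<close> and
    \<open>(t - s) / d\<close> equal, and both vanish as \<open>s\<close> tends to \<open>t\<close>.
    Maximum, minimum and absolute value make the modulus symmetric. The quotient of times confines
    the argument to positive times.\<close>
  define \<omega> where "\<omega> s t = 2 * M * ((max s t / min s t) powr q - 1) + C * \<bar>s - t\<bar>
      + 2 * C * sqrt \<bar>s - t\<bar> + 2 * C * ((1 + sqrt \<bar>s - t\<bar>) powr q - 1) * T" for s t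
  have C: "0 \<le> C" using order_trans[OF norm_ge_zero f(2)] .
  have modulus: "norm (u t x - u s x) \<le> \<omega> s t" if "0 < s" "s \<le> t" "t \<le> T" for s t x
  proof (cases "s = t")
    case False
    define d where "d = sqrt (t - s)"
    have d: "0 < d" "(t - s) / d = d" using that False by (simp_all add: d_def real_div_sqrt)
    have "norm (heat_semigroup t w x - heat_semigroup s w x) \<le> 2 * M * ((t / s) powr q - 1)"
      unfolding q_def using that w by (intro norm_heat_semigroup_time_diff_le) auto
    moreover have "norm (duhamel f t x - duhamel f s x)
        \<le> C * (t - s) + 2 * C * d + 2 * C * ((1 + (t - s) / d) powr q - 1) * s"
      unfolding q_def using that f d(1) by (intro norm_duhamel_time_diff_le) auto
    moreover have "2 * C * ((1 + d) powr q - 1) * s \<le> 2 * C * ((1 + d) powr q - 1) * T"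
      using that d C by (intro mult_left_mono) (auto simp: q_def ge_one_powr_ge_zero)
    moreover have "norm (u t x - u s x) \<le> norm (heat_semigroup t w x - heat_semigroup s w x)
        + norm (duhamel f t x - duhamel f s x)"
      using that fixed[of t x] fixed[of s x]
        norm_triangle_ineq[of "heat_semigroup t w x - heat_semigroup s w x" "duhamel f t x - duhamel f s x"]
      by (simp add: algebra_simps)
    ultimately show ?thesis
      using that unfolding \<omega>_def d(2) by (simp add: d_def max_def min_def)
  qed (use that in \<open>simp add: \<omega>_def\<close>)
  have \<omega>_commute: "\<omega> s t = \<omega> t s" for s t
    by (simp add: \<omega>_def abs_minus_commute max.commute min.commute)
  have dist: "norm (u s x - u t x) \<le> \<omega> s t" if "s \<in> {0<..T}" "t \<in> {0<..T}" for s t x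
    using modulus[of s t x] modulus[of t s x] that \<omega>_commute[of s t]
    by (cases "s \<le> t") (auto simp: norm_minus_commute)
  show ?thesis
    unfolding continuous_on_Linfty_def
  proof (intro conjI ballI)
    fix t assume t: "t \<in> {0<..T}"
    show "u t \<in> Linfty lebesgue" using meas B by (intro LinftyI) auto
    show "((\<lambda>s. Linfty_norm lebesgue (\<lambda>x. u s x - u t x)) \<longlongrightarrow> 0) (at t within {0<..T})"
    proof (rule tendsto_Linfty_norm_zero)
      show "(\<lambda>x. u s x - u t x) \<in> borel_measurable lebesgue" for s
        using meas by (intro borel_measurable_diff)
      show "eventually (\<lambda>s. \<forall>x. norm (u s x - u t x) \<le> \<omega> s t) (at t within {0<..T})"
        using dist[OF _ t] by (auto simp: eventually_at_filter)
      have "((\<lambda>s. \<omega> s t) \<longlongrightarrow> 2 * M * ((max t t / min t t) powr q - 1) + C * \<bar>t - t\<bar>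
          + 2 * C * sqrt \<bar>t - t\<bar> + 2 * C * ((1 + sqrt \<bar>t - t\<bar>) powr q - 1) * T) (at t within {0<..T})"
        unfolding \<omega>_def using t by (intro tendsto_intros) auto
      then show "((\<lambda>s. \<omega> s t) \<longlongrightarrow> 0) (at t within {0<..T})"
        using t by simp
    qed simp
  qed
qed

section \<open>Borel initial data and the choice of the existence time\<close>

lemma Linfty_borel_representative:
  fixes u\<^sub>0 :: "real ^ 'n \<Rightarrow> complex"
  assumes u0: "u\<^sub>0 \<in> Linfty lebesgue" and l: "0 \<le> l" "\<forall>x. Re (u\<^sub>0 x) \<ge> l"
  obtains w M where "w \<in> borel_measurable borel" "AE x in lborel. u\<^sub>0 x = w x"
    "\<And>x. l \<le> Re (w x)" "\<And>x. norm (w x) \<le> M"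
proof -
  have "u\<^sub>0 \<in> borel_measurable lebesgue" using u0 by (simp add: Linfty_def)
  then obtain g where [measurable]: "g \<in> borel_measurable lborel" and g: "AE x in lborel. u\<^sub>0 x = g x"
    using completion_ex_borel_measurable_complex by blast
  obtain M where M: "AE x in lborel. norm (u\<^sub>0 x) \<le> M"
    using Linfty_AE_bounded[OF u0] by (auto simp: AE_completion_iff)
  \<comment> \<open>The constant \<open>l\<close> satisfies the lower bound and has norm
    \<open>l\<close>, whence the bound \<open>max l M\<close>; it replaces \<open>g\<close> on a
    null set only.\<close>
  define w where "w x = (if l \<le> Re (g x) \<and> norm (g x) \<le> M then g x else of_real l)" for x
  show thesis
  proof
    show "w \<in> borel_measurable borel" unfolding w_def[abs_def] by measurable
    show "AE x in lborel. u\<^sub>0 x = w x"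
      using g M
    proof eventually_elim
      case (elim x)
      then show ?case using l(2)[rule_format, of x] by (simp add: w_def)
    qed
    show "l \<le> Re (w x)" "norm (w x) \<le> max l M" for x using l by (auto simp: w_def)
  qed
qed

theorem lemmaA1:
  fixes p lam :: real and u\<^sub>0 :: "real ^ 'n \<Rightarrow> complex"
  assumes "p > 1"
    and "u\<^sub>0 \<in> Linfty lebesgue"
    and "lam > 0"
    and "\<forall>x. Re (u\<^sub>0 x) \<ge> lam"
  shows "\<exists>T\<^sub>1>0. \<exists>u. mild_solution p u\<^sub>0 T\<^sub>1 u \<and>
           (\<forall>v. mild_solution p u\<^sub>0 T\<^sub>1 v \<longrightarrow> (\<forall>t\<in>{0..T\<^sub>1}. AE x in lebesgue. v t x = u t x)) \<and>
           continuous_on_Linfty {0<..T\<^sub>1} u \<and>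
           (\<forall>t\<in>{0..T\<^sub>1}. \<forall>x. Re (u t x) \<ge> lam / 2)"
proof -
  obtain w M where [measurable]: "w \<in> borel_measurable borel" and u0: "AE x in lborel. u\<^sub>0 x = w x"
    and w: "\<And>x. lam \<le> Re (w x)" "\<And>x. norm (w x) \<le> M"
    using Linfty_borel_representative[OF assms(2) less_imp_le[OF assms(3)] assms(4)] by blast
  \<comment> \<open>The Duhamel term may use up \<open>lam / 2\<close>, both in the real part and in
    the norm. With \<open>C\<close> bounding the nonlinearity and \<open>L\<close> its Lipschitz
    constant on the resulting set, \<open>T\<close> is chosen so that
    \<open>C * T \<le> lam / 2\<close> and \<open>L * T \<le> 1 / 2\<close>.\<close>
  define B where "B = M + lam / 2"
  define C where "C = B powr p"
  define L where "L = p * B powr (p - 1)"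
  define T where "T = min (lam / (2 * C)) (1 / (2 * L))"
  have "0 \<le> M" using order_trans[OF norm_ge_zero w(2)] .
  then have B: "0 < B" using assms by (simp add: B_def)
  have pos: "0 < C" "0 < L" using B assms by (simp_all add: C_def L_def)
  have T: "0 < T" using pos assms by (simp add: T_def)
  have "C * T \<le> C * (lam / (2 * C))" "L * T \<le> L * (1 / (2 * L))"
    using pos unfolding T_def by (intro mult_left_mono; simp)+
  then have CT: "C * T \<le> lam / 2" and LT: "L * T \<le> 1 / 2" using pos by simp_all
  let ?K = "{z. lam / 2 \<le> Re z \<and> norm z \<le> B}"
  have "\<exists>u :: real \<Rightarrow> real ^ 'n \<Rightarrow> complex.
    case_prod u \<in> borel_measurable (borel \<Otimes>\<^sub>M borel) \<and> (\<forall>t x. u t x \<in> ?K) \<and>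
    (\<forall>t\<in>{0..T}. \<forall>x. u t x = heat_semigroup t w x + duhamel (\<lambda>s y. halfpow p (u s y)) t x)"
  proof (rule ex_mild_fixed_point[OF refl])
    show "norm (halfpow p z) \<le> C" if "z \<in> ?K" for z
      unfolding C_def using that assms by (intro norm_halfpow_le) auto
    show "norm (halfpow p z - halfpow p z') \<le> L * norm (z - z')" if "z \<in> ?K" "z' \<in> ?K" for z z'
      unfolding L_def using that assms by (intro norm_halfpow_diff_le) auto
  qed (use w LT CT T pos in \<open>auto simp: B_def\<close>)
  then obtain u :: "real \<Rightarrow> real ^ 'n \<Rightarrow> complex" where
    u [measurable]: "case_prod u \<in> borel_measurable (borel \<Otimes>\<^sub>M borel)"
    and K: "\<And>t x. u t x \<in> ?K"
    and fixed: "\<And>t x. t \<in> {0..T} \<Longrightarrow>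
      u t x = heat_semigroup t w x + duhamel (\<lambda>s y. halfpow p (u s y)) t x"
    by blast
  have lower: "lam / 2 \<le> Re (u t x)" and upper: "norm (u t x) \<le> B" and Re_pos: "0 < Re (u t x)" for t x
    using K[of t x] assms(3) by auto
  have source: "(\<lambda>(s, y). halfpow p (u s y)) \<in> borel_measurable (borel \<Otimes>\<^sub>M borel)"
    by measurable
  have "mild_solution p u\<^sub>0 T u"
    unfolding mild_solution_def
  proof (intro conjI ballI)
    have "case_prod u \<in> borel_measurable lebesgue"
      using u by (simp add: borel_prod measurable_completion)
    then have "case_prod u \<in> borel_measurable (lebesgue_on ({0<..<T} \<times> UNIV))"
      by (rule measurable_restrict_space1)
    then show "(\<lambda>(t, x). u t x) \<in> Linfty (lebesgue_on ({0<..<T} \<times> UNIV))"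
      using upper by (intro LinftyI[where B = B]) auto
    fix t assume t: "t \<in> {0..T}"
    show "u t \<in> Linfty lebesgue"
      using upper borel_measurable_section[OF u] by (intro LinftyI[where B = B]) (auto intro: measurable_completion)
    show "AE x in lebesgue. Re (u t x) > 0" using Re_pos by simp
    have "AE x in lborel. u t x = heat_semigroup t u\<^sub>0 x + duhamel (\<lambda>s y. cpow p (u s y)) t x"
      using u0
    proof eventually_elim
      case (elim x)
      have "heat_semigroup t u\<^sub>0 x = heat_semigroup t w x"
        using u0 elim by (intro heat_semigroup_eq_if_AE_eq) auto
      then show ?case using fixed[OF t] by (simp add: halfpow_eq_cpow[OF Re_pos])
    qed
    then show "AE x in lebesgue. u t x = heat_semigroup t u\<^sub>0 x +
        (LINT s:{0..t}|lebesgue. heat_semigroup (t - s) (\<lambda>y. cpow p (u s y)) x)"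
      by (simp add: duhamel_def AE_completion_iff)
  qed
  moreover have "AE x in lebesgue. v t x = u t x" if "mild_solution p u\<^sub>0 T v" "t \<in> {0..T}" for v t
    using mild_solution_unique[OF less_imp_le[OF assms(1)] that(1) u0 _ u upper Re_pos fixed that(2)]
    by (simp add: AE_completion_iff)
  moreover have "continuous_on_Linfty {0<..T} u"
    using u source _ _ w(2) upper fixed
  proof (rule mild_solution_continuous)
    show "norm (halfpow p (u s y)) \<le> C" for s y
      unfolding C_def using upper assms(1) by (intro norm_halfpow_le) auto
  qed measurable
  ultimately show ?thesis using T lower by blast
qed

end
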